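(* Let $A \in \mathbb{C}^{m \times n}$ ($m \ge 2n$) be a partial isometry of rank $r$. For any partition \[ A = \begin{pmatrix} A_1 \\ A_2 \end{pmatrix}, \quad A_1 \in \mathbb{C}^{m_1 \times n}, \ A_2 \in \mathbb{C}^{m_2 \times n}, \quad m_1,m_2 \ge n, \quad m_1 + m_2 = m, \] there exist $U_1 \in \mathbb{C}^{m_1 \times n}$, $U_2 \in \mathbb{C}^{m_2 \times n}$, and $C,S,V_1 \in \mathbb{C}^{n \times n}$ such that $U_1$, $U_2$, and $V_1$ have orthonormal columns, $C$ and $S$ are diagonal with nonnegative entries, \[ C^2+S^2 = \begin{pmatrix} I_r & 0 \\ 0 & 0_{n-r} \end{pmatrix}, \] and \[ A = \begin{pmatrix} U_1 & 0 \\ 0 & U_2 \end{pmatrix} \begin{pmatrix} C \\ S \end{pmatrix} V_1^*. \]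
   Context: A matrix $A \in \mathbb{C}^{m\times n}$ is a partial isometry if $AA^*A = A$ (equivalently, every singular value of $A$ is $0$ or $1$). $A^*$ denotes the conjugate transpose, $I_r$ the $r \times r$ identity matrix and $0_{n-r}$ the $(n-r)\times(n-r)$ zero matrix. *)

theory Defs
  imports "Jordan_Normal_Form.Schur_Decomposition" "Jordan_Normal_Form.DL_Rank"
begin

definition partial_isometry :: "complex mat \<Rightarrow> bool" where
  "partial_isometry A \<longleftrightarrow> A * mat_adjoint A * A = A"

definition orthonormal_columns :: "complex mat \<Rightarrow> bool" where
  "orthonormal_columns U \<longleftrightarrow>
    (\<forall>i<dim_col U. \<forall>j<dim_col U. col U i \<bullet>c col U j = (if i = j then 1 else 0))"

text \<open>The order on \<^typ>\<open>complex\<close> is the one of \<^theory>\<open>HOL-Library.Complex_Order\<close>, so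
  \<open>0 \<le> z\<close> says that \<open>z\<close> is real and nonnegative.\<close>

definition nonneg_diagonal :: "complex mat \<Rightarrow> bool" where
  "nonneg_diagonal D \<longleftrightarrow>
    diagonal_mat D \<and> (\<forall>i<dim_row D. \<forall>j<dim_col D. 0 \<le> D $$ (i, j))"

end

theory Submission
  imports Defs
begin

text \<open>
  Write \<open>P = A\<^sup>*A\<close>. Since \<open>A A\<^sup>*A = A\<close>, \<open>P\<close> is an orthogonal projection with \<open>A P = A\<close>, and the partition
  of \<open>A\<close> gives \<open>P = A\<^sub>1\<^sup>*A\<^sub>1 + A\<^sub>2\<^sup>*A\<^sub>2\<close> and \<open>A\<^sub>1 P = A\<^sub>1\<close>. Because \<open>A\<^sub>1\<^sup>*A\<^sub>1\<close> vanishes on the kernel of \<open>P\<close>, the two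
  Hermitian matrices \<open>A\<^sub>1\<^sup>*A\<^sub>1\<close> and \<open>P\<close> commute, and a single unitary \<open>V\<close> diagonalises both, with
  \<open>V\<^sup>*P V\<close> a block identity followed by zeros (\<open>simultaneous_diagonalization\<close>). Then \<open>V\<close> also
  diagonalises the difference \<open>A\<^sub>2\<^sup>*A\<^sub>2\<close>.

  In other words, the columns of \<open>A\<^sub>1 V\<close> are pairwise orthogonal, and so are those of \<open>A\<^sub>2 V\<close>. Dividing
  the nonzero columns by their norms and completing to an orthonormal family, which the
  inequalities \<open>n \<le> m\<^sub>1\<close> and \<open>n \<le> m\<^sub>2\<close> permit, gives \<open>A\<^sub>1 V = U\<^sub>1 C\<close> and \<open>A\<^sub>2 V = U\<^sub>2 S\<close> with nonnegative
  diagonal \<open>C\<close> and \<open>S\<close> (\<open>orthogonal_columns_factorization\<close>). The sum \<open>C\<^sup>2 + S\<^sup>2\<close> is then the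
  Gram matrix \<open>V\<^sup>*P V\<close> of \<open>A V\<close>, computed block by block. The size of its identity block is the
  rank of \<open>A\<close>, because \<open>A V\<close> consists of that many orthonormal columns and zero columns
  (\<open>rank_partial_isometry\<close>).
\<close>

section \<open>Adjoints and orthonormal columns\<close>

text \<open>Columns of products are to be rewritten to \<open>A *\<^sub>v col B j\<close> (\<open>col_mult2\<close>) and not, by the competing
  rule, to vectors of scalar products.\<close>

declare col_mult [simp del]

lemma mat_adjoint_dim [simp]:
  "dim_row (mat_adjoint A) = dim_col A" "dim_col (mat_adjoint A) = dim_row A"
  unfolding mat_adjoint_def by auto

lemma mat_adjoint_carrier [simp, intro]:
  "A \<in> carrier_mat m n \<Longrightarrow> mat_adjoint A \<in> carrier_mat n m"
  by (auto intro!: carrier_matI)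

lemma mat_adjoint_index [simp]:
  "i < dim_col A \<Longrightarrow> j < dim_row A \<Longrightarrow> mat_adjoint A $$ (i, j) = conjugate (A $$ (j, i))"
  unfolding mat_adjoint_def by (simp add: mat_of_rows_def)

lemma mat_adjoint_adjoint [simp]: "mat_adjoint (mat_adjoint A) = A"
  by (rule eq_matI) auto

lemma mat_adjoint_mult:
  fixes A B :: "complex mat"
  assumes "A \<in> carrier_mat m k" "B \<in> carrier_mat k n"
  shows "mat_adjoint (A * B) = mat_adjoint B * mat_adjoint A"
  by (rule eq_matI) (use assms in \<open>auto simp: scalar_prod_def mult.commute\<close>)

lemma mat_adjoint_add:
  fixes A B :: "complex mat"
  assumes "A \<in> carrier_mat m n" "B \<in> carrier_mat m n"
  shows "mat_adjoint (A + B) = mat_adjoint A + mat_adjoint B"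
  by (rule eq_matI) (use assms in auto)

text \<open>The entries of \<open>X\<^sup>*Y\<close> are inner products of columns, so statements about orthogonality of
  columns become matrix identities.\<close>

lemma adjoint_mult_index:
  fixes X Y :: "complex mat"
  assumes "X \<in> carrier_mat m k" "Y \<in> carrier_mat m l" "i < k" "j < l"
  shows "(mat_adjoint X * Y) $$ (i, j) = col Y j \<bullet>c col X i"
  using assms by (auto simp: scalar_prod_def mult.commute)

lemma orthonormal_columns_iff:
  assumes "U \<in> carrier_mat m n"
  shows "orthonormal_columns U \<longleftrightarrow> mat_adjoint U * U = 1\<^sub>m n" (is "?L \<longleftrightarrow> ?R")
proof
  assume ?L
  then show ?R
    using assms unfolding orthonormal_columns_def
    by (intro eq_matI) (auto simp: adjoint_mult_index[of U m n U n] simp del: index_mult_mat(1))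
next
  assume R: ?R
  have "col U i \<bullet>c col U j = (if i = j then 1 else 0)" if "i < n" "j < n" for i j
    using adjoint_mult_index[OF assms assms, of j i] that unfolding R by auto
  then show ?L using assms unfolding orthonormal_columns_def by auto
qed

lemma unitary_adjoint_right:
  assumes "V \<in> carrier_mat n n" "orthonormal_columns V"
  shows "V * mat_adjoint V = 1\<^sub>m n"
  using mat_mult_left_right_inverse[of "mat_adjoint V" n V] assms
  by (simp add: orthonormal_columns_iff)

section \<open>Completion of orthonormal families\<close>

lemma exists_unit_multiple:
  fixes v :: "complex vec"
  assumes v: "v \<in> carrier_vec n" "v \<noteq> 0\<^sub>v n"
  shows "\<exists>c. (c \<cdot>\<^sub>v v) \<bullet>c (c \<cdot>\<^sub>v v) = 1"
proof -
  define s where "s = v \<bullet>c v"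
  have "s > 0" unfolding s_def using v by simp
  then have s: "s = complex_of_real (Re s)" "Re s > 0"
    by (auto simp: less_complex_def complex_eq_iff)
  define c where "c = complex_of_real (1 / sqrt (Re s))"
  have "c * cnj c * s = complex_of_real ((1 / sqrt (Re s)) * (1 / sqrt (Re s)) * Re s)"
    by (subst s(1)) (simp only: c_def complex_cnj_complex_of_real of_real_mult)
  also have "\<dots> = 1" using s(2) by (simp add: field_simps flip: of_real_mult)
  finally have "c * cnj c * s = 1" .
  moreover have "(c \<cdot>\<^sub>v v) \<bullet>c (c \<cdot>\<^sub>v v) = c * cnj c * s"
    using v unfolding s_def by (simp add: conjugate_smult_vec)
  ultimately show ?thesis by auto
qed

text \<open>A family indexed by fewer than \<open>m\<close> indices imposes fewer than \<open>m\<close> linear conditions on a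
  vector of length \<open>m\<close>. Padding the conditions with zero rows to a square system makes the
  determinant vanish, which produces a nonzero solution.\<close>

lemma exists_unit_vec_orthogonal:
  fixes f :: "nat \<Rightarrow> complex vec"
  assumes f: "\<And>i. i \<in> I \<Longrightarrow> f i \<in> carrier_vec m"
    and I: "I \<subset> {..<m}"
  shows "\<exists>u \<in> carrier_vec m. u \<bullet>c u = 1 \<and> (\<forall>i\<in>I. u \<bullet>c f i = 0)"
proof -
  obtain k where k: "k < m" "k \<notin> I" using I by auto
  define g where "g i = (if i \<in> I then conjugate (f i) else 0\<^sub>v m)" for i
  define M where "M = mat\<^sub>r m m g"
  have g: "g i \<in> carrier_vec m" for i using f unfolding g_def by auto
  have M: "M \<in> carrier_mat m m" unfolding M_def by auto
  have "g = (\<lambda>i. if i = k then 0\<^sub>v m else g i)" using k unfolding g_def by auto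
  then have "det M = 0" using det_row_0[OF k(1), of g] g unfolding M_def by auto
  then obtain v where v: "v \<in> carrier_vec m" "v \<noteq> 0\<^sub>v m" "M *\<^sub>v v = 0\<^sub>v m"
    using det_0_iff_vec_prod_zero_field[OF M] by auto
  have orth: "v \<bullet>c f i = 0" if "i \<in> I" for i
  proof -
    have i: "i < m" using I that by auto
    have "(M *\<^sub>v v) $ i = g i \<bullet> v" using i g M unfolding M_def by simp
    then show ?thesis
      using v i that f[OF that] comm_scalar_prod[of v m "conjugate (f i)"] unfolding g_def by simp
  qed
  obtain c where c: "(c \<cdot>\<^sub>v v) \<bullet>c (c \<cdot>\<^sub>v v) = 1"
    using exists_unit_multiple[OF v(1,2)] by blast
  have "(c \<cdot>\<^sub>v v) \<bullet>c f i = 0" if "i \<in> I" for i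
    using orth[OF that] v f[OF that] by simp
  then show ?thesis using v c by (intro bexI[of _ "c \<cdot>\<^sub>v v"]) auto
qed

text \<open>The given vectors occupy prescribed columns \<open>I\<close>, not the first ones, because below they are
  the normalised nonzero columns of a matrix whose zero columns may be anywhere.\<close>

lemma extend_to_orthonormal_columns:
  fixes f :: "nat \<Rightarrow> complex vec"
  assumes "n \<le> m" and "I \<subseteq> {..<n}"
    and "\<And>i. i \<in> I \<Longrightarrow> f i \<in> carrier_vec m"
    and "\<And>i j. i \<in> I \<Longrightarrow> j \<in> I \<Longrightarrow> f i \<bullet>c f j = (if i = j then 1 else 0)"
  shows "\<exists>U \<in> carrier_mat m n. orthonormal_columns U \<and> (\<forall>i\<in>I. col U i = f i)"
  using assms(2-)
proof (induction "card ({..<n} - I)" arbitrary: I f)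
  case 0
  then have I: "I = {..<n}" by auto
  define U where "U = mat_of_cols m (map f [0..<n])"
  have "U \<in> carrier_mat m n" unfolding U_def by (auto intro!: carrier_matI)
  moreover have "col U i = f i" if "i < n" for i
    using that 0(3) I unfolding U_def by (subst col_mat_of_cols) auto
  ultimately show ?case using 0(4) I unfolding orthonormal_columns_def
    by (intro bexI[of _ U]) auto
next
  case (Suc d)
  then obtain k where k: "k < n" "k \<notin> I"
    by (metis DiffE card.empty emptyE equals0I lessThan_iff old.nat.distinct(2))
  have "I \<subset> {..<m}" using Suc(3) k assms(1) by auto
  then obtain u where u: "u \<in> carrier_vec m" "u \<bullet>c u = 1" "\<And>i. i \<in> I \<Longrightarrow> u \<bullet>c f i = 0"
    using exists_unit_vec_orthogonal[of I f m] Suc(4) by blast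
  have u': "f i \<bullet>c u = 0" if "i \<in> I" for i
    using u(1) u(3)[OF that] Suc(4)[OF that]
    by (metis conjugate_conjugate_sprod conjugate_vec_sprod_comm conjugate_zero_iff)
  have "\<exists>U \<in> carrier_mat m n. orthonormal_columns U \<and> (\<forall>i\<in>insert k I. col U i = (f(k := u)) i)"
  proof (rule Suc(1))
    have "{..<n} - insert k I = ({..<n} - I) - {k}" by auto
    then show "d = card ({..<n} - insert k I)" using Suc(2) k by simp
    show "insert k I \<subseteq> {..<n}" using k Suc(3) by auto
    show "\<And>i. i \<in> insert k I \<Longrightarrow> (f(k := u)) i \<in> carrier_vec m" using u Suc(4) by auto
    show "(f(k := u)) i \<bullet>c (f(k := u)) j = (if i = j then 1 else 0)"
      if "i \<in> insert k I" "j \<in> insert k I" for i j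
      using that u u' k(2) Suc(5) by auto
  qed
  then show ?case using k(2) by (metis fun_upd_other insertCI)
qed

text \<open>The matrix \<open>C\<close> carries the norms of the columns of \<open>X\<close>, and a nonzero column divided by its
  norm is the corresponding column of \<open>U\<close>. A zero column leaves its column of \<open>U\<close> free; since
  \<open>n \<le> m\<close>, the free columns can be filled by orthonormal completion.\<close>

lemma orthogonal_columns_factorization:
  fixes X :: "complex mat"
  assumes X: "X \<in> carrier_mat m n" and "n \<le> m"
    and diag: "diagonal_mat (mat_adjoint X * X)"
  shows "\<exists>U \<in> carrier_mat m n. \<exists>C \<in> carrier_mat n n.
    orthonormal_columns U \<and> nonneg_diagonal C \<and> X = U * C"
proof -
  define c where "c j = complex_of_real (sqrt (Re (col X j \<bullet>c col X j)))" for j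
  have sq: "col X j \<bullet>c col X j = c j * c j" for j
  proof -
    have "col X j \<bullet>c col X j \<ge> 0" by auto
    then show ?thesis
      unfolding c_def by (auto simp: less_eq_complex_def complex_eq_iff simp flip: of_real_mult)
  qed
  define I where "I = {j. j < n \<and> c j \<noteq> 0}"
  define f where "f j = (1 / c j) \<cdot>\<^sub>v col X j" for j
  have f: "f i \<in> carrier_vec m" for i unfolding f_def using X by (simp add: carrier_vecI)
  have cc: "conjugate (c j) = c j" for j by (simp add: c_def)
  have "f i \<bullet>c f j = (if i = j then 1 else 0)" if "i \<in> I" "j \<in> I" for i j
  proof -
    have "f i \<bullet>c f j = (1 / c i) * (1 / c j) * (col X i \<bullet>c col X j)"
      unfolding f_def using X cc[of j] by (simp add: conjugate_smult_vec)
    moreover have "i \<noteq> j \<Longrightarrow> col X i \<bullet>c col X j = 0"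
      using that diag adjoint_mult_index[OF X X, of j i] X unfolding I_def diagonal_mat_def by auto
    ultimately show ?thesis using that sq[of i] unfolding I_def by auto
  qed
  then obtain U where U: "U \<in> carrier_mat m n" "orthonormal_columns U"
    and Uf: "\<And>i. i \<in> I \<Longrightarrow> col U i = f i"
    using extend_to_orthonormal_columns[OF \<open>n \<le> m\<close>, of I f] f unfolding I_def by auto
  define C where "C = mat_diag n c"
  have C: "C \<in> carrier_mat n n" unfolding C_def by simp
  have "col X j = c j \<cdot>\<^sub>v col U j" if "j < n" for j
  proof (cases "c j = 0")
    case True
    then have "col X j = 0\<^sub>v m"
      using sq[of j] X by (metis carrier_matD(1) col_dim conjugate_square_eq_0_vec mult_zero_left)
    then show ?thesis using True U X by (intro eq_vecI) auto
  next
    case False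
    then have "c j \<cdot>\<^sub>v f j = col X j" unfolding f_def by (simp add: smult_smult_assoc)
    then show ?thesis using False that Uf[of j] unfolding I_def by auto
  qed
  then have "X $$ (i, j) = c j * U $$ (i, j)" if "i < m" "j < n" for i j
    using that X U(1) by (metis carrier_matD index_col index_smult_vec(1) dim_col)
  then have "X = U * C"
    using X U(1) unfolding C_def by (subst mat_diag_mult_right[OF U(1)]) (auto intro!: eq_matI)
  moreover have "0 \<le> Re (col X j \<bullet>c col X j)" for j
    using conjugate_square_ge_0_vec[of "col X j"] by (simp add: less_eq_complex_def)
  then have "nonneg_diagonal C"
    unfolding nonneg_diagonal_def diagonal_mat_def C_def c_def
    by (auto simp: mat_diag_def less_eq_complex_def)
  ultimately show ?thesis using U C by blast
qed

section \<open>Diagonalisation of Hermitian matrices\<close>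

text \<open>The spectral theorem, by completing a unit eigenvector to an orthonormal basis and recursing on the
  orthogonal complement of the eigenvector. The order of the eigenvalues
  is prescribed by the list \<open>es\<close>, so that later the nonzero ones can be put first.\<close>

lemma unitary_diagonalization_of_hermitian:
  fixes K :: "complex mat"
  assumes "K \<in> carrier_mat n n" and "mat_adjoint K = K"
    and "char_poly K = (\<Prod>e\<leftarrow>es. [:- e, 1:])"
  shows "\<exists>V \<in> carrier_mat n n. orthonormal_columns V \<and> K * V = V * mat_diag n ((!) es)"
  using assms
proof (induction es arbitrary: n K)
  case Nil
  then have "n = 0" using degree_monic_char_poly[of K n] by simp
  then show ?case using Nil(1)
    by (intro bexI[of _ "1\<^sub>m 0"] conjI eq_matI) (auto simp: orthonormal_columns_def mat_diag_def)
next
  case (Cons e es n K)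
  note K = \<open>K \<in> carrier_mat n n\<close>
  have "eigenvalue K e" unfolding eigenvalue_root_char_poly[OF K] Cons(4) by simp
  then obtain w where w: "w \<in> carrier_vec n" "w \<noteq> 0\<^sub>v n" "K *\<^sub>v w = e \<cdot>\<^sub>v w"
    using K unfolding eigenvalue_def eigenvector_def by auto
  then have "n \<noteq> 0" by auto
  then obtain l where n: "n = Suc l" by (cases n) auto
  obtain c where c: "(c \<cdot>\<^sub>v w) \<bullet>c (c \<cdot>\<^sub>v w) = 1" using exists_unit_multiple[OF w(1,2)] by blast
  define v where "v = c \<cdot>\<^sub>v w"
  have v: "v \<in> carrier_vec n" "v \<bullet>c v = 1" using w c unfolding v_def by auto
  have Kv: "K *\<^sub>v v = e \<cdot>\<^sub>v v"
    unfolding v_def using mult_mat_vec[OF K w(1)] w(3) by (simp add: smult_smult_assoc mult.commute)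
  (* In an orthonormal basis that begins with the eigenvector v, the first column of K is e times
     the first unit vector; as K is Hermitian, so is its first row, and K splits off a 1 x 1 block. *)
  obtain W where W: "W \<in> carrier_mat n n" "orthonormal_columns W" "col W 0 = v"
    using extend_to_orthonormal_columns[of n n "{0}" "\<lambda>_. v"] v n by auto
  have WW: "mat_adjoint W * W = 1\<^sub>m n" "W * mat_adjoint W = 1\<^sub>m n"
    using W unitary_adjoint_right by (auto simp: orthonormal_columns_iff)
  note assoc = assoc_mult_mat[of _ n n _ n _ n]
  note aW = mat_adjoint_carrier[OF W(1)]
  define A where "A = mat_adjoint W * (K * W)"
  have A: "A \<in> carrier_mat n n" unfolding A_def using W K by (meson aW mult_carrier_mat)
  have KW: "K * W = W * A"
  proof -
    have "W * A = (W * mat_adjoint W) * (K * W)"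
      unfolding A_def using W K by (simp add: assoc)
    then show ?thesis using W K by (simp add: WW)
  qed
  have Aherm: "mat_adjoint A = A"
    unfolding A_def using W K Cons(3)
    by (simp add: mat_adjoint_mult[of _ n n _ n] assoc)
  have A0: "A $$ (i, 0) = (if i = 0 then e else 0)" if "i < n" for i
  proof -
    have "A $$ (i, 0) = (e \<cdot>\<^sub>v v) \<bullet>c col W i"
      unfolding A_def using that n K W Kv
      by (subst adjoint_mult_index[of W n n _ n]) auto
    also have "\<dots> = e * (col W 0 \<bullet>c col W i)" using v W that by simp
    finally show ?thesis using W n that unfolding orthonormal_columns_def by auto
  qed
  have A0': "A $$ (0, j) = (if j = 0 then e else 0)" if "j < n" for j
  proof (cases "j = 0")
    case False
    have "A $$ (0, j) = mat_adjoint A $$ (0, j)" by (simp add: Aherm)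
    also have "\<dots> = conjugate (A $$ (j, 0))" using that n A by simp
    finally show ?thesis using False A0[OF that] by simp
  qed (use A0 that in simp)
  define E where "E = mat 1 1 (\<lambda>_. e)"
  have E: "E \<in> carrier_mat 1 1" unfolding E_def by simp
  define B where "B = mat l l (\<lambda>(i, j). A $$ (Suc i, Suc j))"
  have B: "B \<in> carrier_mat l l" unfolding B_def by simp
  have block: "A = four_block_mat E (0\<^sub>m 1 l) (0\<^sub>m l 1) B"
    using A A0 A0' n by (intro eq_matI) (auto simp: E_def B_def)
  have "similar_mat A K"
    unfolding similar_mat_def
    by (intro exI[of _ "mat_adjoint W"] exI[of _ W] similar_mat_witI[of _ _ n])
       (use A K W WW aW in \<open>auto simp: A_def assoc\<close>)
  then have "char_poly K = char_poly E * char_poly B"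
    using char_poly_similar[of A K] char_poly_four_block_zeros_col[OF E _ B, of "0\<^sub>m 1 l"]
    unfolding block by auto
  moreover have "char_poly E = [:- e, 1:]"
    unfolding E_def char_poly_defs by (subst det_single) auto
  ultimately have "[:- e, 1:] * (\<Prod>e\<leftarrow>es. [:- e, 1:]) = [:- e, 1:] * char_poly B"
    using Cons(4) by simp
  then have cB: "char_poly B = (\<Prod>e\<leftarrow>es. [:- e, 1:])" by (subst (asm) mult_left_cancel) auto
  have Bherm: "mat_adjoint B = B"
  proof (rule eq_matI)
    fix i j assume "i < dim_row B" "j < dim_col B"
    then have ij: "i < l" "j < l" using B by auto
    have "A $$ (Suc i, Suc j) = mat_adjoint A $$ (Suc i, Suc j)" by (simp add: Aherm)
    also have "\<dots> = conjugate (A $$ (Suc j, Suc i))"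
      using ij n A by (subst mat_adjoint_index) auto
    finally show "mat_adjoint B $$ (i, j) = B $$ (i, j)" using ij by (simp add: B_def)
  qed (use B in auto)
  obtain U where U: "U \<in> carrier_mat l l" "orthonormal_columns U"
      "B * U = U * mat_diag l ((!) es)"
    using Cons(1)[OF B Bherm cB] by blast
  define U' where "U' = four_block_mat (1\<^sub>m 1) (0\<^sub>m 1 l) (0\<^sub>m l 1) U"
  have U': "U' \<in> carrier_mat n n" unfolding U'_def using U n by (auto intro!: carrier_matI)
  have D: "mat_diag n ((!) (e # es)) = four_block_mat E (0\<^sub>m 1 l) (0\<^sub>m l 1) (mat_diag l ((!) es))"
    unfolding mat_diag_def E_def n by (rule eq_matI) auto
  have Dl: "mat_diag l ((!) es) \<in> carrier_mat l l" by simp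
  have "A * U' = four_block_mat E (0\<^sub>m 1 l) (0\<^sub>m l 1) (B * U)"
    unfolding block U'_def using E B U
    by (subst mult_four_block_mat[of _ 1 1 _ l _ l _ _ 1 _ l]) auto
  moreover have "U' * mat_diag n ((!) (e # es)) = four_block_mat E (0\<^sub>m 1 l) (0\<^sub>m l 1) (B * U)"
    unfolding D U'_def using E B U Dl left_mult_zero_mat[OF Dl, of 1]
    by (subst mult_four_block_mat[of _ 1 1 _ l _ l _ _ 1 _ l]) auto
  ultimately have AU: "A * U' = U' * mat_diag n ((!) (e # es))" by simp
  have adjU': "mat_adjoint U' = four_block_mat (1\<^sub>m 1) (0\<^sub>m 1 l) (0\<^sub>m l 1) (mat_adjoint U)"
    unfolding U'_def using U by (intro eq_matI) auto
  have "mat_adjoint U' * U' = four_block_mat (1\<^sub>m 1) (0\<^sub>m 1 l) (0\<^sub>m l 1) (1\<^sub>m l)"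
    unfolding adjU' unfolding U'_def using U
    by (subst mult_four_block_mat[of _ 1 1 _ l _ l _ _ 1 _ l])
       (auto simp: orthonormal_columns_iff[OF U(1)])
  also have "\<dots> = 1\<^sub>m n" unfolding n by (rule eq_matI) auto
  finally have UU: "mat_adjoint U' * U' = 1\<^sub>m n" .
  define V where "V = W * U'"
  have V: "V \<in> carrier_mat n n" unfolding V_def using W U' by simp
  have "mat_adjoint V * V = mat_adjoint U' * ((mat_adjoint W * W) * U')"
    unfolding V_def using W U' by (simp add: mat_adjoint_mult[of _ n n _ n] assoc)
  also have "\<dots> = 1\<^sub>m n" using U' UU by (simp add: WW)
  finally have "orthonormal_columns V" by (simp add: orthonormal_columns_iff[OF V])
  moreover have "K * V = V * mat_diag n ((!) (e # es))"
  proof -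
    have "K * V = (K * W) * U'" unfolding V_def using K W U' by (simp add: assoc)
    also have "\<dots> = W * (A * U')" unfolding KW using A W U' by (simp add: assoc)
    also have "\<dots> = V * mat_diag n ((!) (e # es))"
      unfolding AU V_def using W U' by (simp add: assoc)
    finally show ?thesis .
  qed
  ultimately show ?case using V by blast
qed

text \<open>Passing from the vector \<open>v\<close> to the one-column matrix \<open>X\<close> turns the moving of \<open>M\<close> across the inner
  product into associativity of matrix multiplication.\<close>

lemma adjoint_mult_self_inner:
  fixes M :: "complex mat"
  assumes M: "M \<in> carrier_mat m n" and v: "v \<in> carrier_vec n"
  shows "(mat_adjoint M * M *\<^sub>v v) \<bullet>c v = (M *\<^sub>v v) \<bullet>c (M *\<^sub>v v)"
proof -
  define X where "X = mat_of_cols n [v]"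
  have X: "X \<in> carrier_mat n 1" "col X 0 = v"
    unfolding X_def using v by (auto intro!: carrier_matI)
  note aM = mat_adjoint_carrier[OF M] and aX = mat_adjoint_carrier[OF X(1)]
  have "(mat_adjoint (M * X) * (M * X)) $$ (0, 0) = (M *\<^sub>v v) \<bullet>c (M *\<^sub>v v)"
    using M X by (subst adjoint_mult_index[of _ m 1 _ 1]) auto
  moreover have "mat_adjoint (M * X) * (M * X) = mat_adjoint X * (mat_adjoint M * M * X)"
    unfolding mat_adjoint_mult[OF M X(1)] using M X(1) aM aX
    by (simp add: assoc_mult_mat[of _ 1 n _ m _ 1] assoc_mult_mat[of _ n m _ n _ 1])
  moreover have "(mat_adjoint X * (mat_adjoint M * M * X)) $$ (0, 0) = (mat_adjoint M * M *\<^sub>v v) \<bullet>c v"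
    using col_mult2[OF mult_carrier_mat[OF aM M] X(1), of 0] X M aM
    by (subst adjoint_mult_index[of _ n 1 _ 1]) (auto simp del: assoc_mult_mat col_mult2)
  ultimately show ?thesis by simp
qed

lemma exists_nonzero_first_factorization:
  fixes K :: "complex mat"
  assumes K: "K \<in> carrier_mat n n"
  shows "\<exists>es k. char_poly K = (\<Prod>e\<leftarrow>es. [:- e, 1:]) \<and> k \<le> n \<and>
    (\<forall>i<n. es ! i \<noteq> 0 \<longleftrightarrow> i < k)"
proof -
  obtain as where as: "char_poly K = (\<Prod>a\<leftarrow>as. [:- a, 1:])" "length as = n"
    using char_poly_factorized[OF K] by auto
  define bs cs where "bs = filter (\<lambda>a. a \<noteq> 0) as" and "cs = filter (\<lambda>a. \<not> a \<noteq> 0) as"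
  have "(\<Prod>a\<leftarrow>bs @ cs. [:- a, 1:]) = (\<Prod>a\<leftarrow>as. [:- a, 1:])"
    unfolding bs_def cs_def by (induction as) (simp_all add: algebra_simps)
  moreover have len: "length bs + length cs = n"
    unfolding bs_def cs_def as(2)[symmetric] by (rule sum_length_filter_compl)
  moreover have "(bs @ cs) ! i \<noteq> 0 \<longleftrightarrow> i < length bs" if "i < n" for i
  proof (cases "i < length bs")
    case True
    then have "bs ! i \<in> set bs" by simp
    then show ?thesis using True unfolding bs_def nth_append by simp
  next
    case False
    then have "cs ! (i - length bs) \<in> set cs" using that len by simp
    then show ?thesis using False unfolding cs_def by (simp add: nth_append)
  qed
  ultimately show ?thesis using as(1) by (intro exI[of _ "bs @ cs"] exI[of _ "length bs"]) auto
qed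

text \<open>The hypotheses say that \<open>P\<close> is an orthogonal projection and that \<open>B\<close> vanishes on its kernel. Put
  \<open>H = B\<^sup>*B\<close> and diagonalise the single matrix \<open>K = H + P\<close>. Its range lies in that of \<open>P\<close>, so \<open>P\<close> fixes
  every eigenvector of \<open>K\<close> with nonzero eigenvalue. An eigenvector \<open>v\<close> with eigenvalue \<open>0\<close> satisfies
  \<open>0 = \<langle>v, K v\<rangle> = \<parallel>B v\<parallel>\<^sup>2 + \<parallel>P v\<parallel>\<^sup>2\<close>, so \<open>P\<close> kills it. Hence the eigenvectors of \<open>K\<close> diagonalise \<open>P\<close>
  and therefore also \<open>H = K - P\<close>.\<close>

lemma simultaneous_diagonalization:
  fixes B P :: "complex mat"
  assumes B: "B \<in> carrier_mat m n" and P: "P \<in> carrier_mat n n"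
    and Pherm: "mat_adjoint P = P" and PP: "P * P = P" and BP: "B * P = B"
  shows "\<exists>V \<in> carrier_mat n n. \<exists>k\<le>n. orthonormal_columns V \<and>
    diagonal_mat (mat_adjoint (B * V) * (B * V)) \<and>
    P * V = V * mat_diag n (\<lambda>i. if i < k then 1 else 0)"
proof -
  define H where "H = mat_adjoint B * B"
  define K where "K = H + P"
  have aB: "mat_adjoint B \<in> carrier_mat n m" using B by simp
  have H: "H \<in> carrier_mat n n" and K: "K \<in> carrier_mat n n"
    unfolding K_def H_def using aB B P by auto
  have "mat_adjoint H = H" unfolding H_def
    using B by (simp add: mat_adjoint_mult[of _ n m _ n])
  then have Kherm: "mat_adjoint K = K"
    unfolding K_def by (simp add: mat_adjoint_add[OF H P] Pherm)
  have "P * mat_adjoint B = mat_adjoint B"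
    using arg_cong[OF BP, of mat_adjoint] by (simp add: mat_adjoint_mult[OF B P] Pherm)
  then have "P * H = H" unfolding H_def using aB B P
    by (metis assoc_mult_mat)
  then have PK: "P * K = K" unfolding K_def
    using mult_add_distrib_mat[OF P H P] PP by simp
  obtain es k where es: "char_poly K = (\<Prod>e\<leftarrow>es. [:- e, 1:])" "k \<le> n"
      "\<And>i. i < n \<Longrightarrow> es ! i \<noteq> 0 \<longleftrightarrow> i < k"
    using exists_nonzero_first_factorization[OF K] by blast
  obtain V where V: "V \<in> carrier_mat n n" "orthonormal_columns V"
      "K * V = V * mat_diag n ((!) es)"
    using unitary_diagonalization_of_hermitian[OF K Kherm es(1)] by blast
  note aV = mat_adjoint_carrier[OF V(1)]
  have VV: "mat_adjoint V * V = 1\<^sub>m n" using V by (simp add: orthonormal_columns_iff)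
  let ?E = "mat_diag n (\<lambda>i. if i < k then 1 else 0 :: complex)"
  have Kv: "K *\<^sub>v col V i = es ! i \<cdot>\<^sub>v col V i" if "i < n" for i
  proof -
    have "col (K * V) i = es ! i \<cdot>\<^sub>v col V i"
      unfolding V(3) mat_diag_mult_right[OF V(1)] using that V(1) by (intro eq_vecI) auto
    then show ?thesis using that K V(1) by simp
  qed
  have Pv: "P *\<^sub>v col V i = (if i < k then 1 else 0) \<cdot>\<^sub>v col V i" if i: "i < n" for i
  proof -
    let ?v = "col V i" and ?e = "es ! i"
    have v: "?v \<in> carrier_vec n" using V(1) by auto
    show ?thesis
    proof (cases "i < k")
      case True
      then have e: "?e \<noteq> 0" using es(3)[OF i] by simp
      (* P K = K, so P v and v agree after multiplication by the nonzero e. *)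
      have "?e \<cdot>\<^sub>v (P *\<^sub>v ?v) = P *\<^sub>v (K *\<^sub>v ?v)"
        unfolding Kv[OF i] using P v by (simp add: mult_mat_vec)
      also have "\<dots> = ?e \<cdot>\<^sub>v ?v"
        using assoc_mult_mat_vec[OF P K v] Kv[OF i] by (simp add: PK)
      finally have "(1 / ?e) \<cdot>\<^sub>v (?e \<cdot>\<^sub>v (P *\<^sub>v ?v)) = (1 / ?e) \<cdot>\<^sub>v (?e \<cdot>\<^sub>v ?v)" by simp
      then show ?thesis using e True by (simp add: smult_smult_assoc)
    next
      case False
      then have e: "?e = 0" using es(3)[OF i] by simp
      note form = adjoint_mult_self_inner[OF _ v]
      have "0 = (K *\<^sub>v ?v) \<bullet>c ?v" unfolding Kv[OF i] e using v by simp
      also have "K *\<^sub>v ?v = H *\<^sub>v ?v + P *\<^sub>v ?v"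
        unfolding K_def by (rule add_mult_distrib_mat_vec[OF H P v])
      also have "\<dots> \<bullet>c ?v = (H *\<^sub>v ?v) \<bullet>c ?v + (P *\<^sub>v ?v) \<bullet>c ?v"
        by (rule add_scalar_prod_distrib[of _ n]) (use H P v in auto)
      also have "(H *\<^sub>v ?v) \<bullet>c ?v = (B *\<^sub>v ?v) \<bullet>c (B *\<^sub>v ?v)"
        unfolding H_def by (rule form[OF B])
      also have "(P *\<^sub>v ?v) \<bullet>c ?v = (P *\<^sub>v ?v) \<bullet>c (P *\<^sub>v ?v)"
        using form[OF P] by (simp add: Pherm PP)
      finally have "(P *\<^sub>v ?v) \<bullet>c (P *\<^sub>v ?v) = 0"
        using conjugate_square_ge_0_vec[of "B *\<^sub>v ?v"] conjugate_square_ge_0_vec[of "P *\<^sub>v ?v"]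
        by (metis add_nonneg_eq_0_iff)
      then have "P *\<^sub>v ?v = 0\<^sub>v n"
        using conjugate_square_eq_0_vec[of "P *\<^sub>v ?v" n] P v by auto
      moreover have "0 \<cdot>\<^sub>v ?v = 0\<^sub>v n" using V(1) by (intro eq_vecI) auto
      ultimately show ?thesis using False by simp
    qed
  qed
  have PV: "P * V = V * ?E"
  proof (rule mat_col_eqI)
    fix i assume "i < dim_col (V * ?E)"
    then have i: "i < n" by (simp add: mat_diag_def)
    have "col (V * ?E) i = (if i < k then 1 else 0) \<cdot>\<^sub>v col V i"
      unfolding mat_diag_mult_right[OF V(1)] using i V(1) by (intro eq_vecI) auto
    then show "col (P * V) i = col (V * ?E) i" using Pv[OF i] i P V(1) by simp
  qed (use P V in \<open>auto simp: mat_diag_def\<close>)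
  have "mat_adjoint (B * V) * (B * V) = mat_adjoint V * (H * V)"
    unfolding H_def mat_adjoint_mult[OF B V(1)] using aB B V(1) aV
    by (simp add: assoc_mult_mat[of _ n n _ m _ n] assoc_mult_mat[of _ n m _ n _ n])
  also have "\<dots> = mat_diag n ((!) es) - ?E"
  proof -
    have "H = K - P" unfolding K_def using H P by (intro eq_matI) auto
    then have "H * V = V * mat_diag n ((!) es) - V * ?E"
      using minus_mult_distrib_mat[OF K P V(1)] V(3) PV by simp
    then have "mat_adjoint V * (H * V) =
        mat_adjoint V * (V * mat_diag n ((!) es)) - mat_adjoint V * (V * ?E)"
      using mult_minus_distrib_mat[OF aV, of "V * mat_diag n ((!) es)" n "V * ?E"] V(1) by simp
    also have "\<dots> = (mat_adjoint V * V) * mat_diag n ((!) es) - (mat_adjoint V * V) * ?E"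
      using aV V(1) by (simp add: assoc_mult_mat[of _ n n _ n _ n])
    finally show ?thesis unfolding VV left_mult_one_mat[OF mat_diag_dim] .
  qed
  finally have "diagonal_mat (mat_adjoint (B * V) * (B * V))"
    by (auto simp: diagonal_mat_def mat_diag_def)
  then show ?thesis using V PV es(2) by blast
qed

section \<open>Rank\<close>

lemma span_cols_mult_subset:
  fixes X Y :: "complex mat"
  assumes X: "X \<in> carrier_mat m k" and Y: "Y \<in> carrier_mat k n"
  shows "LinearCombinations.module.span class_ring (module_vec TYPE(complex) m) (set (cols (X * Y)))
    \<subseteq> LinearCombinations.module.span class_ring (module_vec TYPE(complex) m) (set (cols X))"
proof -
  interpret vec_space "TYPE(complex)" m .
  have cX: "set (cols X) \<subseteq> carrier_vec m" using cols_dim X by blast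
  have eq: "mat_of_cols m (cols X) = X" using X mat_of_cols_cols[of X] by simp
  show ?thesis
  proof (rule span_subsetI[OF cX], rule subsetI)
    fix x assume "x \<in> set (cols (X * Y))"
    then obtain j where j: "j < n" "x = col (X * Y) j"
      using Y by (auto simp: cols_def)
    then have x: "x = X *\<^sub>v col Y j" using X Y by simp
    have "mat_of_cols m (cols X) *\<^sub>v col Y j \<in> span (set (cols X))"
      by (subst mat_of_cols_mult_as_finsum) (use X Y cX in \<open>auto\<close>)
    then show "x \<in> span (set (cols X))" unfolding x eq .
  qed
qed

text \<open>The two factorisations say that \<open>A\<close> and \<open>W\<close> have the same column space, and orthonormal columns
  are linearly independent.\<close>

lemma rank_eq_of_orthonormal_factor:
  fixes A W :: "complex mat"
  assumes A: "A \<in> carrier_mat m n" and W: "W \<in> carrier_mat m k" "orthonormal_columns W"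
    and Y: "Y \<in> carrier_mat k n" and Z: "Z \<in> carrier_mat n k"
    and AW: "A = W * Y" and WA: "W = A * Z"
  shows "vec_space.rank m A = k"
proof -
  interpret vec_space "TYPE(complex)" m .
  have "span (set (cols A)) = span (set (cols W))"
    using span_cols_mult_subset[OF A Z, folded WA] span_cols_mult_subset[OF W(1) Y, folded AW] by blast
  then have "rank A = rank W" unfolding rank_def by simp
  also have "\<dots> = k"
  proof (rule lin_indpt_full_rank[OF W(1)])
    show dist: "distinct (cols W)"
      using W unfolding distinct_conv_nth orthonormal_columns_def by (auto) (metis zero_neq_one)
    show "lin_indpt (set (cols W))"
    proof
      assume "lin_dep (set (cols W))"
      then obtain v where v: "v \<in> carrier_vec k" "v \<noteq> 0\<^sub>v k" "W *\<^sub>v v = 0\<^sub>v m"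
        using lin_depE[OF W(1) _ dist] by blast
      have "mat_adjoint W * W *\<^sub>v v = mat_adjoint W *\<^sub>v (W *\<^sub>v v)"
        using W v by (intro assoc_mult_mat_vec) auto
      also have "\<dots> = 0\<^sub>v k" unfolding v(3) using W by auto
      finally show False using v W by (simp add: orthonormal_columns_iff[OF W(1)])
    qed
  qed
  finally show ?thesis .
qed

section \<open>Matrices stacked on top of each other\<close>

lemma append_rows_mult:
  assumes A: "A \<in> carrier_mat m1 n" and B: "B \<in> carrier_mat m2 n" and X: "X \<in> carrier_mat n l"
  shows "(A @\<^sub>r B) * X = (A * X) @\<^sub>r (B * X)"
proof (rule mat_col_eqI)
  note AB = carrier_append_rows[OF A B]
  have AX: "A * X \<in> carrier_mat m1 l" and BX: "B * X \<in> carrier_mat m2 l" using A B X by auto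
  note ABX = carrier_append_rows[OF AX BX]
  show "dim_row ((A @\<^sub>r B) * X) = dim_row ((A * X) @\<^sub>r (B * X))"
    and "dim_col ((A @\<^sub>r B) * X) = dim_col ((A * X) @\<^sub>r (B * X))"
    using AB ABX X by auto
  fix j assume "j < dim_col ((A * X) @\<^sub>r (B * X))"
  then have j: "j < l" using ABX by auto
  have "col ((A @\<^sub>r B) * X) j = (A @\<^sub>r B) *\<^sub>v col X j" by (rule col_mult2[OF AB X j])
  also have "\<dots> = (A *\<^sub>v col X j) @\<^sub>v (B *\<^sub>v col X j)"
    by (rule mat_mult_append[OF A B]) (use X in auto)
  also have "\<dots> = col ((A * X) @\<^sub>r (B * X)) j"
    unfolding append_rows_def using AX BX j A B X
    by (subst col_four_block_mat[of _ m1 l _ 0 _ m2]) auto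
  finally show "col ((A @\<^sub>r B) * X) j = col ((A * X) @\<^sub>r (B * X)) j" .
qed

lemma append_rows_eq_imp_top_eq:
  assumes "A \<in> carrier_mat m1 n" "A' \<in> carrier_mat m1 n" "B \<in> carrier_mat m2 n" "B' \<in> carrier_mat m2 n"
    and eq: "A @\<^sub>r B = A' @\<^sub>r B'"
  shows "A = A'"
proof (rule eq_matI)
  fix i j assume "i < dim_row A'" "j < dim_col A'"
  then show "A $$ (i, j) = A' $$ (i, j)"
    using arg_cong[OF eq, of "\<lambda>M. M $$ (i, j)"] assms(1-4)
    unfolding append_rows_def by auto
qed (use assms in auto)

lemma adjoint_append_rows_mult:
  fixes A B :: "complex mat"
  assumes A: "A \<in> carrier_mat m1 n" and B: "B \<in> carrier_mat m2 n"
  shows "mat_adjoint (A @\<^sub>r B) * (A @\<^sub>r B) = mat_adjoint A * A + mat_adjoint B * B"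
proof (rule eq_matI)
  note AB = carrier_append_rows[OF A B]
  fix i j assume "i < dim_row (mat_adjoint A * A + mat_adjoint B * B)"
    and "j < dim_col (mat_adjoint A * A + mat_adjoint B * B)"
  then have ij: "i < n" "j < n" using B by auto
  have col: "col (A @\<^sub>r B) k = col A k @\<^sub>v col B k" if "k < n" for k
    unfolding append_rows_def using A B that
    by (subst col_four_block_mat[of _ m1 n _ 0 _ m2]) auto
  have conj: "conjugate (a @\<^sub>v b) = conjugate a @\<^sub>v conjugate b" for a b :: "complex vec"
    by (intro eq_vecI) auto
  have "(mat_adjoint (A @\<^sub>r B) * (A @\<^sub>r B)) $$ (i, j) = col A j \<bullet>c col A i + col B j \<bullet>c col B i"
    unfolding adjoint_mult_index[OF AB AB ij] col[OF ij(1)] col[OF ij(2)] conj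
    by (rule scalar_prod_append[of _ m1 _ m2]) (use A B in auto)
  then show "(mat_adjoint (A @\<^sub>r B) * (A @\<^sub>r B)) $$ (i, j) =
      (mat_adjoint A * A + mat_adjoint B * B) $$ (i, j)"
    using ij A B adjoint_mult_index[OF A A ij] adjoint_mult_index[OF B B ij] by simp
qed (use A B carrier_matD[OF carrier_append_rows[OF A B]] in auto)

section \<open>Partial isometries\<close>

lemma gram_of_orthonormal_times_diagonal:
  fixes U C :: "complex mat"
  assumes U: "U \<in> carrier_mat m n" "orthonormal_columns U"
    and C: "C \<in> carrier_mat n n" "nonneg_diagonal C"
  shows "mat_adjoint (U * C) * (U * C) = C ^\<^sub>m 2"
proof -
  have "mat_adjoint C = C"
  proof (rule eq_matI)
    fix i j assume "i < dim_row C" "j < dim_col C"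
    then show "mat_adjoint C $$ (i, j) = C $$ (i, j)"
      using C unfolding nonneg_diagonal_def diagonal_mat_def
      by (cases "i = j") (auto simp: less_eq_complex_def complex_eq_iff)
  qed (use C in auto)
  then have "mat_adjoint (U * C) * (U * C) = C * (mat_adjoint U * (U * C))"
    unfolding mat_adjoint_mult[OF U(1) C(1)] using U C
    by (simp add: assoc_mult_mat[of C n n _ m _ n] mult_carrier_mat[of U m n C n])
  also have "mat_adjoint U * (U * C) = (mat_adjoint U * U) * C"
    using U C by (simp add: assoc_mult_mat[of _ n m _ n _ n])
  finally show ?thesis
    using U C by (simp add: orthonormal_columns_iff[OF U(1)] numeral_2_eq_2)
qed

text \<open>The matrix \<open>A\<close> maps an orthonormal basis of eigenvectors of \<open>A\<^sup>*A\<close> to pairwise orthogonal vectors whose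
  squared norms are the eigenvalues.\<close>

lemma gram_of_orthonormal_eigenvectors:
  fixes A V :: "complex mat"
  assumes A: "A \<in> carrier_mat m n" and V: "V \<in> carrier_mat n n" "orthonormal_columns V"
    and PV: "mat_adjoint A * A * V = V * mat_diag n d"
  shows "mat_adjoint (A * V) * (A * V) = mat_diag n d"
proof -
  note aA = mat_adjoint_carrier[OF A] and aV = mat_adjoint_carrier[OF V(1)]
  have "mat_adjoint (A * V) * (A * V) = mat_adjoint V * (mat_adjoint A * A * V)"
    unfolding mat_adjoint_mult[OF A V(1)] using A V(1) aA aV
    by (simp add: assoc_mult_mat[of _ n n _ m _ n] assoc_mult_mat[of _ n m _ n _ n])
  also have "\<dots> = (mat_adjoint V * V) * mat_diag n d"
    unfolding PV using V(1) aV by (simp add: assoc_mult_mat[of _ n n _ n _ n])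
  also have "\<dots> = mat_diag n d"
    using V(2) by (simp only: orthonormal_columns_iff[OF V(1)] left_mult_one_mat[OF mat_diag_dim])
  finally show ?thesis .
qed

text \<open>The first \<open>k\<close> columns of \<open>V\<close> form the matrix \<open>V J\<close>, where \<open>J\<close> consists of the first \<open>k\<close> columns of the
  identity. They span the range of \<open>A\<^sup>*A\<close>, on which \<open>A\<close> is isometric; so \<open>A V J\<close> has \<open>k\<close> orthonormal columns, and
  \<open>A = A A\<^sup>*A\<close> factors through it.\<close>

lemma rank_partial_isometry:
  fixes A V :: "complex mat"
  assumes A: "A \<in> carrier_mat m n" and pi: "partial_isometry A"
    and V: "V \<in> carrier_mat n n" "orthonormal_columns V" and k: "k \<le> n"
    and PV': "mat_adjoint A * A * V = V * mat_diag n (\<lambda>i. if i < k then 1 else 0)"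
  shows "vec_space.rank m A = k"
proof -
  let ?E = "mat_diag n (\<lambda>i. if i < k then 1 else 0 :: complex)"
  note aA = mat_adjoint_carrier[OF A] and aV = mat_adjoint_carrier[OF V(1)]
  note assoc = assoc_mult_mat[of _ n n _ n _ n]
  define P where "P = mat_adjoint A * A"
  have P: "P \<in> carrier_mat n n" unfolding P_def by (rule mult_carrier_mat[OF aA A])
  note PV = PV'[folded P_def]
  have AP: "A * P = A"
    using pi A aA unfolding partial_isometry_def P_def
    by (simp add: assoc_mult_mat[of _ m n _ m _ n])
  have VV: "V * mat_adjoint V = 1\<^sub>m n" by (rule unitary_adjoint_right[OF V])
  have AV: "A * V \<in> carrier_mat m n" using A V by simp
  note gram = gram_of_orthonormal_eigenvectors[OF A V PV']
  define J where "J = mat n k (\<lambda>(i, j). if i = j then 1 else 0 :: complex)"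
  have J: "J \<in> carrier_mat n k" unfolding J_def by simp
  note aJ = mat_adjoint_carrier[OF J]
  note aJV = mult_carrier_mat[OF aJ aV]
  have JJ: "J * mat_adjoint J = ?E"
    by (rule eq_matI) (use k in \<open>auto simp: J_def scalar_prod_def mat_diag_def if_distrib sum.delta' cong: if_cong\<close>)
  have EJ: "?E * J = J"
    unfolding mat_diag_mult_left[OF J] by (rule eq_matI) (auto simp: J_def)
  have J1: "mat_adjoint J * J = 1\<^sub>m k"
    by (rule eq_matI) (use k in \<open>auto simp: J_def scalar_prod_def if_distrib cong: if_cong\<close>)
  define W where "W = (A * V) * J"
  have W: "W \<in> carrier_mat m k" unfolding W_def using AV J by simp
  have "mat_adjoint W * W = mat_adjoint J * (mat_adjoint (A * V) * ((A * V) * J))"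
    unfolding W_def mat_adjoint_mult[OF AV J]
    using AV J by (intro assoc_mult_mat[of _ k n _ m _ k]) auto
  also have "mat_adjoint (A * V) * ((A * V) * J) = ?E * J"
    unfolding gram[symmetric] using AV J by (intro assoc_mult_mat[symmetric, of _ n m _ n _ k]) auto
  finally have W': "orthonormal_columns W"
    unfolding EJ J1 by (simp add: orthonormal_columns_iff[OF W])
  have AW: "A = W * (mat_adjoint J * mat_adjoint V)"
  proof -
    have "W * (mat_adjoint J * mat_adjoint V) = (A * V) * (J * (mat_adjoint J * mat_adjoint V))"
      unfolding W_def by (rule assoc_mult_mat[OF AV J aJV])
    also have "J * (mat_adjoint J * mat_adjoint V) = ?E * mat_adjoint V"
      unfolding JJ[symmetric] using J aJ aV by (intro assoc_mult_mat[symmetric, of _ n k _ n _ n]) auto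
    also have "(A * V) * (?E * mat_adjoint V) = A * ((V * ?E) * mat_adjoint V)"
      using assoc_mult_mat[OF A V(1) mult_carrier_mat[OF mat_diag_dim aV]]
        assoc_mult_mat[OF V(1) mat_diag_dim aV] by simp
    also have "\<dots> = A * (P * (V * mat_adjoint V))"
      unfolding PV[symmetric] using P V(1) aV by (simp add: assoc)
    also have "\<dots> = A" unfolding VV using P AP by simp
    finally show ?thesis by simp
  qed
  have WA: "W = A * (V * J)" unfolding W_def by (rule assoc_mult_mat[OF A V(1) J])
  show ?thesis
    by (rule rank_eq_of_orthonormal_factor[OF A W W' aJV mult_carrier_mat[OF V(1) J] AW WA])
qed

theorem theorem2p1:
  fixes A A1 A2 :: "complex mat" and m n r m1 m2 :: nat
  assumes "A \<in> carrier_mat m n"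
    and "m \<ge> 2 * n"
    and "partial_isometry A"
    and "vec_space.rank m A = r"
    and "A = A1 @\<^sub>r A2"
    and "A1 \<in> carrier_mat m1 n"
    and "A2 \<in> carrier_mat m2 n"
    and "m1 \<ge> n"
    and "m2 \<ge> n"
    and "m1 + m2 = m"
  shows "\<exists>U1 U2 C S V1.
      U1 \<in> carrier_mat m1 n \<and> U2 \<in> carrier_mat m2 n \<and>
      C \<in> carrier_mat n n \<and> S \<in> carrier_mat n n \<and> V1 \<in> carrier_mat n n \<and>
      orthonormal_columns U1 \<and> orthonormal_columns U2 \<and> orthonormal_columns V1 \<and>
      nonneg_diagonal C \<and> nonneg_diagonal S \<and>
      C ^\<^sub>m 2 + S ^\<^sub>m 2 =
        four_block_mat (1\<^sub>m r) (0\<^sub>m r (n - r)) (0\<^sub>m (n - r) r) (0\<^sub>m (n - r) (n - r)) \<and>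
      A = four_block_mat U1 (0\<^sub>m m1 n) (0\<^sub>m m2 n) U2 * (C @\<^sub>r S) * mat_adjoint V1"
proof -
  note A = assms(1) and A1 = assms(6) and A2 = assms(7)
  note aA = mat_adjoint_carrier[OF A]
  define P where "P = mat_adjoint A * A"
  have P: "P \<in> carrier_mat n n" unfolding P_def by (rule mult_carrier_mat[OF aA A])
  have AP: "A * P = A"
    using assms(3) A aA unfolding partial_isometry_def P_def
    by (simp add: assoc_mult_mat[of _ m n _ m _ n])
  have PP: "P * P = P"
  proof -
    have "P * P = mat_adjoint A * (A * P)"
      unfolding P_def using A aA P[unfolded P_def] by (intro assoc_mult_mat) auto
    then show ?thesis unfolding AP by (simp add: P_def)
  qed
  have Pherm: "mat_adjoint P = P" unfolding P_def by (simp add: mat_adjoint_mult[OF aA A])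
  have "(A1 * P) @\<^sub>r (A2 * P) = A1 @\<^sub>r A2"
    using AP append_rows_mult[OF A1 A2 P] assms(5) by simp
  then have A1P: "A1 * P = A1"
    using append_rows_eq_imp_top_eq[of "A1 * P" m1 n A1 "A2 * P" m2 A2] A1 A2 P by auto
  obtain V k where V: "V \<in> carrier_mat n n" "orthonormal_columns V" and k: "k \<le> n"
    and diag1: "diagonal_mat (mat_adjoint (A1 * V) * (A1 * V))"
    and PV: "P * V = V * mat_diag n (\<lambda>i. if i < k then 1 else 0)"
    using simultaneous_diagonalization[OF A1 P Pherm PP A1P] by blast
  let ?E = "mat_diag n (\<lambda>i. if i < k then 1 else 0 :: complex)"
  note aV = mat_adjoint_carrier[OF V(1)]
  have VV: "V * mat_adjoint V = 1\<^sub>m n" by (rule unitary_adjoint_right[OF V])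
  have A1V: "A1 * V \<in> carrier_mat m1 n" and A2V: "A2 * V \<in> carrier_mat m2 n" using A1 A2 V by auto
  have gram: "mat_adjoint (A * V) * (A * V) = ?E"
    using gram_of_orthonormal_eigenvectors[OF A V PV[unfolded P_def]] .
  have AV_split: "A * V = (A1 * V) @\<^sub>r (A2 * V)"
    using append_rows_mult[OF A1 A2 V(1)] assms(5) by simp
  have gram_split: "mat_adjoint (A1 * V) * (A1 * V) + mat_adjoint (A2 * V) * (A2 * V) = ?E"
    using adjoint_append_rows_mult[OF A1V A2V] gram unfolding AV_split by simp
  (* The Gram matrix of A2 V is the difference of two diagonal matrices. *)
  have diag2: "diagonal_mat (mat_adjoint (A2 * V) * (A2 * V))"
    unfolding diagonal_mat_def
  proof (intro allI impI)
    fix i j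
    assume "i < dim_row (mat_adjoint (A2 * V) * (A2 * V))"
      and "j < dim_col (mat_adjoint (A2 * V) * (A2 * V))" and ij: "i \<noteq> j"
    then have lt: "i < n" "j < n" using A2V V by auto
    have "(mat_adjoint (A1 * V) * (A1 * V)) $$ (i, j) + (mat_adjoint (A2 * V) * (A2 * V)) $$ (i, j)
        = ?E $$ (i, j)"
      unfolding gram_split[symmetric] using lt V A1V A2V by (subst index_add_mat) auto
    moreover have "(mat_adjoint (A1 * V) * (A1 * V)) $$ (i, j) = 0"
      using diag1 lt ij V A1V unfolding diagonal_mat_def by auto
    ultimately show "(mat_adjoint (A2 * V) * (A2 * V)) $$ (i, j) = 0"
      using lt ij by (simp add: mat_diag_def)
  qed
  obtain U1 C where U1: "U1 \<in> carrier_mat m1 n" "orthonormal_columns U1"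
    and C: "C \<in> carrier_mat n n" "nonneg_diagonal C" and UC: "A1 * V = U1 * C"
    using orthogonal_columns_factorization[OF A1V assms(8) diag1] by blast
  obtain U2 S where U2: "U2 \<in> carrier_mat m2 n" "orthonormal_columns U2"
    and S: "S \<in> carrier_mat n n" "nonneg_diagonal S" and US: "A2 * V = U2 * S"
    using orthogonal_columns_factorization[OF A2V assms(9) diag2] by blast
  have rk: "r = k"
    using rank_partial_isometry[OF A assms(3) V k PV[unfolded P_def]] assms(4) by simp
  have "C ^\<^sub>m 2 + S ^\<^sub>m 2 = ?E"
    using gram_split gram_of_orthonormal_times_diagonal[OF U1 C] gram_of_orthonormal_times_diagonal[OF U2 S]
    unfolding UC US by simp
  also have "\<dots> = four_block_mat (1\<^sub>m r) (0\<^sub>m r (n - r)) (0\<^sub>m (n - r) r) (0\<^sub>m (n - r) (n - r))"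
    unfolding rk using k by (intro eq_matI) (auto simp: mat_diag_def)
  finally have sum: "C ^\<^sub>m 2 + S ^\<^sub>m 2 =
      four_block_mat (1\<^sub>m r) (0\<^sub>m r (n - r)) (0\<^sub>m (n - r) r) (0\<^sub>m (n - r) (n - r))" .
  have "four_block_mat U1 (0\<^sub>m m1 n) (0\<^sub>m m2 n) U2 * (C @\<^sub>r S) = (U1 * C) @\<^sub>r (U2 * S)"
    unfolding append_rows_def using U1 U2 C S
    by (subst mult_four_block_mat[of _ m1 n _ n _ m2 _ _ n _ 0]) auto
  also have "\<dots> * mat_adjoint V = A * (V * mat_adjoint V)"
    unfolding UC[symmetric] US[symmetric] AV_split[symmetric]
    using A V(1) aV by (rule assoc_mult_mat)
  finally have "A = four_block_mat U1 (0\<^sub>m m1 n) (0\<^sub>m m2 n) U2 * (C @\<^sub>r S) * mat_adjoint V"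
    unfolding VV using A by simp
  then show ?thesis using U1 U2 C S V sum by blast
qed

end
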